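(* Let $\{S_i\}_{i\in\mathcal{I}}$ be an arbitrary IFS. Let $\Delta\in\mathcal{F}_t$ have children $(\Delta_1,\ldots,\Delta_n)$ in $\mathcal{F}_{\operatorname{tg}(\Delta)}$, ordered from left to right. Then for any $\Delta'\in\mathcal{F}_s$ with $\mathcal V(\Delta)=\mathcal V(\Delta')$ and children $(\Delta_1',\ldots,\Delta_{n'}')$ in $\mathcal{F}_{\operatorname{tg}(\Delta')}$, ordered from left to right, we have $n=n'$ and for any $1\le i\le n$, (i) $\mathcal V(\Delta_i')=\mathcal V(\Delta_i)$, (ii) $q(\Delta',\Delta_i')=q(\Delta,\Delta_i)$, (iii) $\dfrac{\operatorname{diam}(\Delta_i')}{\operatorname{diam}(\Delta')}=\dfrac{\operatorname{diam}(\Delta_i)}{\operatorname{diam}(\Delta)}$, and (iv) $\dfrac{\operatorname{tg}(\Delta_i)}{\operatorname{tg}(\Delta)}=\dfrac{\operatorname{tg}(\Delta_i')}{\operatorname{tg}(\Delta')}$.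
   Context: IFS. An iterated function system of similarities (IFS) is a finite set of maps $S_i(x)=r_ix+d_i$ on $\mathbb{R}$, $i\in\mathcal{I}$, with $0<|r_i|<1$ and $\#\mathcal{I}\ge 2$. Its attractor $K$ is the unique non-empty compact set with $K=\bigcup_{i}S_i(K)$. Standing assumptions: $K$ is not a singleton and (normalization) the convex hull of $K$ is $[0,1]$. $\mathcal{I}^*$ is the set of finite words; for $\sigma=(\sigma_1,\dots,\sigma_n)$, $S_\sigma=S_{\sigma_1}\circ\cdots\circ S_{\sigma_n}$, $r_\sigma=\prod r_{\sigma_k}$, and $\sigma^-$ is $\sigma$ with the last letter deleted; for the empty word $S_\emptyset=\mathrm{id}$, $r_\emptyset=1$. For $t>0$, $\Lambda_t=\{\sigma\in\mathcal I^*:|r_\sigma|<t\le|r_{\sigma^-}|\}$ (convention: $|r_{\emptyset^-}|=\infty$, so $\Lambda_t=\{\emptyset\}$ for $t>1$). Net intervals. For $t>0$ let $h_1<\dots<h_{s(t)}$ be the distinct elements of $\{S_\sigma(0),S_\sigma(1):\sigma\in\Lambda_t\}$. The net intervals of generation $t$ are the elements of $\mathcal{F}_t=\{[h_j,h_{j+1}]:1\le j<s(t),\ (h_j,h_{j+1})\cap K\ne\emptyset\}$. A net interval is always considered together with its generation. $T_\Delta(x)=rx+a$ is the map with $r>0$ and $T_\Delta([0,1])=\Delta$. The neighbour set of $\Delta\in\mathcal F_t$ is $\mathcal V(\Delta)=\mathcal{V}_t(\Delta)=\{T_\Delta^{-1}\circ S_\sigma:\sigma\in\Lambda_t,\ S_\sigma(K)\cap\Delta^\circ\neq\emptyset\}$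 (a set of functions). The transition generation of $\Delta\in\mathcal F_t$ is $\operatorname{tg}(\Delta)=\max\{|r_\sigma|:\sigma\in\Lambda_t,S_\sigma(K)\cap\Delta^\circ\ne\emptyset\}=\operatorname{diam}(\Delta)\cdot\max\{|R|:(x\mapsto Rx+a)\in\mathcal V(\Delta)\}$; the children of $\Delta$ are the net intervals of generation $\operatorname{tg}(\Delta)$ contained in $\Delta$ (each child is considered with generation $\operatorname{tg}(\Delta)$). The position index of a child $\Delta_i=[a_i,b_i]$ of $\Delta=[a,b]$ is $q(\Delta,\Delta_i)=(a_i-a)/\operatorname{diam}(\Delta)$. *)

theory Defs
  imports "HOL-Analysis.Analysis"
begin

(* An IFS of similarities x \<mapsto> r i * x + d i on the real line together with its attractor K,
   under the normalization that the convex hull of K is the unit interval. The compact non-empty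
   invariant set is unique, so the assumptions determine K. *)
locale ifs =
  fixes I :: "'i set" and r d :: "'i \<Rightarrow> real" and K :: "real set"
  assumes finite_index: "finite I"
    and two_maps: "card I \<ge> 2"
    and ratio: "\<And>i. i \<in> I \<Longrightarrow> 0 < \<bar>r i\<bar> \<and> \<bar>r i\<bar> < 1"
    and K_nonempty: "K \<noteq> {}"
    and K_compact: "compact K"
    and K_invariant: "K = (\<Union>i\<in>I. (\<lambda>x. r i * x + d i) ` K)"
    and K_not_singleton: "\<nexists>x. K = {x}"
    and K_hull: "convex hull K = {0..1}"

(* T_\<Delta>, given by its explicit formula; see affine_to_image and affine_to_unique below. *)
definition affine_to :: "real set \<Rightarrow> real \<Rightarrow> real" where
  "affine_to \<Delta> = (\<lambda>x. diameter \<Delta> * x + Inf \<Delta>)"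

definition position_index :: "real set \<Rightarrow> real set \<Rightarrow> real" where
  "position_index \<Delta> \<Delta>' = (Inf \<Delta>' - Inf \<Delta>) / diameter \<Delta>"

context ifs
begin

definition S :: "'i \<Rightarrow> real \<Rightarrow> real" where
  "S i = (\<lambda>x. r i * x + d i)"

definition word_map :: "'i list \<Rightarrow> real \<Rightarrow> real" where
  "word_map \<sigma> = foldr (\<lambda>i f. S i \<circ> f) \<sigma> id"

definition word_ratio :: "'i list \<Rightarrow> real" where
  "word_ratio \<sigma> = prod_list (map r \<sigma>)"

(* The disjunct \<sigma> = [] encodes the convention that the ratio of the predecessor of the empty
   word is infinite. *)
definition Lambda :: "real \<Rightarrow> 'i list set" where
  "Lambda t = {\<sigma> \<in> lists I. \<bar>word_ratio \<sigma>\<bar> < t \<and> (\<sigma> = [] \<or> t \<le> \<bar>word_ratio (butlast \<sigma>)\<bar>)}"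

definition endpoints :: "real \<Rightarrow> real set" where
  "endpoints t = (\<Union>\<sigma>\<in>Lambda t. {word_map \<sigma> 0, word_map \<sigma> 1})"

(* a and b range over the pairs of consecutive elements of the finite set endpoints t. *)
definition net_intervals :: "real \<Rightarrow> real set set" where
  "net_intervals t = {{a..b} | a b. a \<in> endpoints t \<and> b \<in> endpoints t \<and> a < b \<and>
     {a<..<b} \<inter> endpoints t = {} \<and> {a<..<b} \<inter> K \<noteq> {}}"

(* A net interval is considered together with its generation, so everything that depends on the
   generation takes it as an additional first argument t. *)
definition covering_words :: "real \<Rightarrow> real set \<Rightarrow> 'i list set" where
  "covering_words t \<Delta> = {\<sigma> \<in> Lambda t. word_map \<sigma> ` K \<inter> interior \<Delta> \<noteq> {}}"

definition neighbour_set :: "real \<Rightarrow> real set \<Rightarrow> (real \<Rightarrow> real) set" where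
  "neighbour_set t \<Delta> = {inv (affine_to \<Delta>) \<circ> word_map \<sigma> | \<sigma>. \<sigma> \<in> covering_words t \<Delta>}"

definition tg :: "real \<Rightarrow> real set \<Rightarrow> real" where
  "tg t \<Delta> = Max {\<bar>word_ratio \<sigma>\<bar> | \<sigma>. \<sigma> \<in> covering_words t \<Delta>}"

definition children :: "real \<Rightarrow> real set \<Rightarrow> real set set" where
  "children t \<Delta> = {\<Delta>' \<in> net_intervals (tg t \<Delta>). \<Delta>' \<subseteq> \<Delta>}"

(* The relation on left endpoints is strict, so the list has no repetitions. *)
definition ordered_children :: "real \<Rightarrow> real set \<Rightarrow> real set list \<Rightarrow> bool" where
  "ordered_children t \<Delta> \<Delta>s \<longleftrightarrow>
     set \<Delta>s = children t \<Delta> \<and> sorted_wrt (\<lambda>A B. Inf A < Inf B) \<Delta>s"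

end

lemma affine_to_image:
  assumes "a < b"
  shows "diameter {a..b} > 0" "affine_to {a..b} ` {0..1} = {a..b}"
proof -
  have D: "diameter {a..b} = b - a" using assms by simp
  show "diameter {a..b} > 0" using D assms by simp
  show "affine_to {a..b} ` {0..1} = {a..b}"
    using assms image_affinity_atLeastAtMost[of "b - a" a 0 1]
    by (simp add: affine_to_def D)
qed

lemma affine_to_unique:
  fixes m c :: real
  assumes "m > 0" and "(\<lambda>x. m * x + c) ` {0..1} = {a..b}"
  shows "(\<lambda>x. m * x + c) = affine_to {a..b}"
proof -
  have "{c..m + c} = {a..b}"
    using assms image_affinity_atLeastAtMost[of m c 0 1] by simp
  then have "a = c \<and> b = m + c" using assms(1) by (metis Icc_eq_Icc less_add_same_cancel2 less_imp_le)
  then show ?thesis using assms(1) by (auto simp: affine_to_def)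
qed

context ifs
begin

lemma word_ratio_bound:
  obtains \<rho> where "0 \<le> \<rho>" "\<rho> < 1" "\<And>\<tau>. \<tau> \<in> lists I \<Longrightarrow> \<bar>word_ratio \<tau>\<bar> \<le> \<rho> ^ length \<tau>"
proof -
  define \<rho> where "\<rho> = Max (insert 0 ((\<lambda>i. \<bar>r i\<bar>) ` I))"
  have fin: "finite (insert 0 ((\<lambda>i. \<bar>r i\<bar>) ` I))" using finite_index by simp
  have "\<rho> < 1" unfolding \<rho>_def using fin ratio by (subst Max_less_iff) auto
  moreover have "0 \<le> \<rho>" unfolding \<rho>_def using fin by (intro Max_ge) auto
  moreover have le: "\<bar>r i\<bar> \<le> \<rho>" if "i \<in> I" for i
    unfolding \<rho>_def using fin that by (intro Max_ge) auto
  moreover have "\<bar>word_ratio \<tau>\<bar> \<le> \<rho> ^ length \<tau>" if "\<tau> \<in> lists I" for \<tau>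
    using that
  proof (induction \<tau>)
    case (Cons i \<tau>)
    then have "\<bar>r i\<bar> * \<bar>word_ratio \<tau>\<bar> \<le> \<rho> * \<rho> ^ length \<tau>"
      by (intro mult_mono) (use le \<open>0 \<le> \<rho>\<close> in auto)
    then show ?case by (simp add: word_ratio_def abs_mult)
  qed (simp add: word_ratio_def)
  ultimately show ?thesis using that by blast
qed

lemma Lambda_gt_1:
  assumes "t > 1"
  shows "Lambda t = {[]}"
proof -
  have le: "\<bar>word_ratio \<tau>\<bar> \<le> 1" if "\<tau> \<in> lists I" for \<tau>
  proof -
    obtain \<rho> where "0 \<le> \<rho>" "\<rho> < 1" "\<bar>word_ratio \<tau>\<bar> \<le> \<rho> ^ length \<tau>"
      using word_ratio_bound \<open>\<tau> \<in> lists I\<close> by metis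
    then show ?thesis using power_le_one[of \<rho> "length \<tau>"] by linarith
  qed
  have "butlast \<tau> \<in> lists I" if "\<tau> \<in> lists I" for \<tau>
    using that by (auto dest: in_set_butlastD)
  then have "\<not> t \<le> \<bar>word_ratio (butlast \<tau>)\<bar>" if "\<tau> \<in> lists I" for \<tau>
    using le[of "butlast \<tau>"] that assms by force
  then show ?thesis using assms by (auto simp: Lambda_def word_ratio_def)
qed

lemma finite_Lambda:
  assumes "t > 0"
  shows "finite (Lambda t)"
proof -
  obtain \<rho> where \<rho>: "0 \<le> \<rho>" "\<rho> < 1"
    and pow: "\<And>\<tau>. \<tau> \<in> lists I \<Longrightarrow> \<bar>word_ratio \<tau>\<bar> \<le> \<rho> ^ length \<tau>"
    using word_ratio_bound by blast
  obtain N where N: "\<rho> ^ N < t" using real_arch_pow_inv[OF assms \<rho>(2)] by blast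
  have "length \<tau> \<le> Suc N" if "\<tau> \<in> Lambda t" for \<tau>
  proof (rule ccontr)
    assume "\<not> length \<tau> \<le> Suc N"
    then have long: "\<tau> \<noteq> []" "N \<le> length (butlast \<tau>)" by auto
    have "butlast \<tau> \<in> lists I" using that by (auto simp: Lambda_def dest: in_set_butlastD)
    then have "t \<le> \<rho> ^ length (butlast \<tau>)"
      using pow[of "butlast \<tau>"] that long by (auto simp: Lambda_def)
    also have "\<dots> \<le> \<rho> ^ N" by (rule power_decreasing) (use long \<rho> in auto)
    finally show False using N by simp
  qed
  then have "Lambda t \<subseteq> {xs. set xs \<subseteq> I \<and> length xs \<le> Suc N}"
    by (auto simp: Lambda_def)
  then show ?thesis using finite_lists_length_le[OF finite_index] finite_subset by blast
qed

lemma finite_net_intervals: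
  assumes "t > 0"
  shows "finite (net_intervals t)"
proof -
  have "finite (endpoints t)" using finite_Lambda[OF assms] by (auto simp: endpoints_def)
  moreover have "net_intervals t \<subseteq> (\<lambda>(a, b). {a..b}) ` (endpoints t \<times> endpoints t)"
    by (auto simp: net_intervals_def)
  ultimately show ?thesis using finite_subset by blast
qed

lemma covering_words_nonempty:
  assumes "t > 0" "\<Delta> \<in> net_intervals t"
  shows "covering_words t \<Delta> \<noteq> {}"
proof -
  have step: "\<exists>i\<in>I. x \<in> S i ` K" if "x \<in> K" for x
  proof -
    have "x \<in> (\<Union>i\<in>I. (\<lambda>x. r i * x + d i) ` K)" by (rule subsetD[OF equalityD1[OF K_invariant] that])
    then show ?thesis unfolding S_def by blast
  qed
  have wm: "word_map (\<tau> @ [i]) = word_map \<tau> \<circ> S i" for \<tau> i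
    by (induction \<tau>) (auto simp: word_map_def)
  have wr: "word_ratio (\<tau> @ [i]) = word_ratio \<tau> * r i" for \<tau> i
    by (simp add: word_ratio_def)
  obtain a b x where ab: "\<Delta> = {a..b}" "a < x" "x < b" "x \<in> K"
  proof -
    obtain a b where "\<Delta> = {a..b}" "{a<..<b} \<inter> K \<noteq> {}"
      using assms unfolding net_intervals_def by blast
    then obtain x where "x \<in> {a<..<b} \<inter> K" by blast
    with \<open>\<Delta> = {a..b}\<close> show ?thesis using that[of a b x] by simp
  qed
  have "\<exists>\<tau>\<in>lists I. length \<tau> = n \<and> x \<in> word_map \<tau> ` K \<and> (\<forall>k<n. t \<le> \<bar>word_ratio (take k \<tau>)\<bar>)
      \<or> (\<exists>\<tau>\<in>Lambda t. x \<in> word_map \<tau> ` K)" for n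
  proof (induction n)
    case 0
    then show ?case using ab by (intro bexI[of _ "[]"]) (auto simp: word_map_def)
  next
    case (Suc n)
    show ?case
    proof (cases "\<exists>\<tau>\<in>Lambda t. x \<in> word_map \<tau> ` K")
      case True
      then show ?thesis by (intro bexI[of _ "[]"]) auto
    next
      case False
      with Suc obtain \<tau> where \<tau>: "\<tau> \<in> lists I" "length \<tau> = n" "x \<in> word_map \<tau> ` K"
        "\<forall>k<n. t \<le> \<bar>word_ratio (take k \<tau>)\<bar>" by blast
      have "t \<le> \<bar>word_ratio \<tau>\<bar>"
      proof (rule ccontr)
        assume "\<not> t \<le> \<bar>word_ratio \<tau>\<bar>"
        then have "\<tau> \<in> Lambda t"
          using \<tau> by (cases "\<tau> = []") (auto simp: Lambda_def butlast_conv_take)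
        then show False using False \<tau> by blast
      qed
      obtain y where y: "y \<in> K" "x = word_map \<tau> y" using \<tau> by blast
      obtain i z where "i \<in> I" "z \<in> K" "y = S i z" using step[OF y(1)] by blast
      then have "x \<in> word_map (\<tau> @ [i]) ` K" using y by (auto simp: wm)
      moreover have "t \<le> \<bar>word_ratio (take k (\<tau> @ [i]))\<bar>" if "k < Suc n" for k
        using that \<tau> \<open>t \<le> \<bar>word_ratio \<tau>\<bar>\<close> by (cases "k = n") auto
      ultimately show ?thesis using \<tau> \<open>i \<in> I\<close> by (intro bexI[of _ "\<tau> @ [i]"]) auto
    qed
  qed
  note ext = this
  have "\<exists>\<tau>\<in>Lambda t. x \<in> word_map \<tau> ` K"
  proof (rule ccontr)
    assume no: "\<not> ?thesis"
    obtain \<rho> where \<rho>: "0 \<le> \<rho>" "\<rho> < 1"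
      and pow: "\<And>\<tau>. \<tau> \<in> lists I \<Longrightarrow> \<bar>word_ratio \<tau>\<bar> \<le> \<rho> ^ length \<tau>"
      using word_ratio_bound by blast
    obtain N where N: "\<rho> ^ N < t" using real_arch_pow_inv[OF assms(1) \<rho>(2)] by blast
    obtain \<tau> where \<tau>: "\<tau> \<in> lists I" "length \<tau> = Suc N"
      "\<forall>k<Suc N. t \<le> \<bar>word_ratio (take k \<tau>)\<bar>" using ext[of "Suc N"] no by blast
    have "take N \<tau> \<in> lists I" using \<tau> by (auto dest: in_set_takeD)
    then show False using pow[of "take N \<tau>"] \<tau> N by fastforce
  qed
  then obtain \<tau> where "\<tau> \<in> Lambda t" "x \<in> word_map \<tau> ` K" by blast
  then have "\<tau> \<in> covering_words t \<Delta>" using ab by (auto simp: covering_words_def)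
  then show ?thesis by blast
qed

lemma tg_bounds:
  assumes "t > 0" "\<Delta> \<in> net_intervals t"
  shows "0 < tg t \<Delta>" "tg t \<Delta> < t"
proof -
  have "finite (covering_words t \<Delta>)"
    using finite_Lambda[OF assms(1)] by (auto simp: covering_words_def)
  then have "tg t \<Delta> \<in> {\<bar>word_ratio \<sigma>\<bar> | \<sigma>. \<sigma> \<in> covering_words t \<Delta>}"
    unfolding tg_def using covering_words_nonempty[OF assms] by (intro Max_in) auto
  then obtain \<sigma> where \<sigma>: "\<sigma> \<in> Lambda t" "tg t \<Delta> = \<bar>word_ratio \<sigma>\<bar>"
    by (auto simp: covering_words_def)
  have "word_ratio \<tau> \<noteq> 0" if "\<tau> \<in> lists I" for \<tau>
    using that ratio by (fastforce simp: word_ratio_def prod_list_zero_iff)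
  then show "0 < tg t \<Delta>" "tg t \<Delta> < t" using \<sigma> by (auto simp: Lambda_def)
qed

(* Hence quantifying over ordered_children is never vacuous. *)
lemma ordered_children_exists:
  assumes "t > 0" "\<Delta> \<in> net_intervals t"
  shows "\<exists>!\<Delta>s. ordered_children t \<Delta> \<Delta>s"
proof -
  define C where "C = children t \<Delta>"
  have fin: "finite C"
    using finite_net_intervals[OF tg_bounds(1)[OF assms]] by (simp add: C_def children_def)
  have inj: "inj_on Inf C"
  proof (rule inj_onI)
    fix A B assume "A \<in> C" "B \<in> C" and eq: "Inf A = Inf B"
    then obtain a b a' b' where *: "A = {a..b}" "B = {a'..b'}" "a < b" "a' < b'"
      "b \<in> endpoints (tg t \<Delta>)" "b' \<in> endpoints (tg t \<Delta>)"
      "{a<..<b} \<inter> endpoints (tg t \<Delta>) = {}" "{a'<..<b'} \<inter> endpoints (tg t \<Delta>) = {}"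
      by (auto simp: C_def children_def net_intervals_def)
    then have "a = a'" using eq by simp
    moreover have "b = b'" using * \<open>a = a'\<close>
      by (metis disjoint_iff greaterThanLessThan_iff linorder_neqE_linordered_idom)
    ultimately show "A = B" using * by simp
  qed
  define g where "g = the_inv_into C Inf"
  have g: "g (Inf A) = A" if "A \<in> C" for A
    using that inj by (simp add: g_def the_inv_into_f_f)
  define xs where "xs = map g (sorted_list_of_set (Inf ` C))"
  have "set xs = C" using fin g by (force simp: xs_def)
  moreover have "sorted_wrt (\<lambda>A B. Inf A < Inf B) xs"
    unfolding xs_def sorted_wrt_map
    using strict_sorted_list_of_set[of "Inf ` C"]
    by (rule sorted_wrt_mono_rel[rotated]) (use fin g in auto)
  ultimately have ex: "ordered_children t \<Delta> xs" by (simp add: ordered_children_def C_def)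
  have "ys = xs" if "ordered_children t \<Delta> ys" for ys
  proof -
    have ys: "set ys = C" "sorted_wrt (\<lambda>A B. Inf A < Inf B) ys"
      using that by (auto simp: ordered_children_def C_def)
    then have "sorted_wrt (<) (map Inf ys)" by (simp add: sorted_wrt_map)
    moreover have "sorted_wrt (<) (map Inf xs)"
      using ex by (simp add: ordered_children_def sorted_wrt_map)
    ultimately have "map Inf ys = map Inf xs"
      using ys \<open>set xs = C\<close> by (intro strict_sorted_equal) auto
    then show ?thesis using inj ys \<open>set xs = C\<close> by (intro map_inj_on[of Inf]) auto
  qed
  with ex show ?thesis by blast
qed

end

end

theory Submission
  imports Defs
begin

text \<open>
  The maps \<open>S\<^sub>\<sigma>\<close> covering a net interval \<open>\<Delta>\<close> determine everything about its children. In
  passing to generation \<open>tg(\<Delta>)\<close> the covering maps of maximal contraction ratio are subdivided once,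
  while the remaining ones are kept; a map that does not cover \<open>\<Delta>\<close> has no descendant with an
  endpoint or a point of \<open>K\<close> in the interior of \<open>\<Delta>\<close>, because \<open>0\<close> and \<open>1\<close> belong to \<open>K\<close>. Equality
  of the neighbour sets means that the increasing affine map \<open>\<phi>\<close> taking \<open>\<Delta>\<close> to \<open>\<Delta>'\<close> carries the
  covering maps of \<open>\<Delta>\<close> to those of \<open>\<Delta>'\<close>. As the construction commutes with \<open>\<phi>\<close>, the map \<open>\<phi>\<close>
  carries the children of \<open>\<Delta>\<close> to those of \<open>\<Delta>'\<close>, in order and together with their covering maps.
\<close>

section \<open>Order structure of the line under increasing affine maps\<close>

text \<open>The construction of \<open>net_intervals\<close> detached from the IFS: with the
  endpoints \<open>E\<close> and the set \<open>A\<close> as parameters, both can be moved by an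
  affine map or cut down to one interval.\<close>

definition gaps :: "real set \<Rightarrow> real set \<Rightarrow> real set set" where
  "gaps E A = {{u..v} | u v. u \<in> E \<and> v \<in> E \<and> u < v \<and> {u<..<v} \<inter> E = {} \<and> {u<..<v} \<inter> A \<noteq> {}}"

lemma image_affine_open_interval:
  fixes m c :: real
  assumes "m > 0"
  shows "(\<lambda>x. m * x + c) ` {u<..<v} = {m * u + c<..<m * v + c}"
proof (intro equalityI subsetI)
  fix y assume "y \<in> {m * u + c<..<m * v + c}"
  then have "(y - c) / m \<in> {u<..<v}" "y = m * ((y - c) / m) + c"
    using assms by (auto simp: field_simps)
  then show "y \<in> (\<lambda>x. m * x + c) ` {u<..<v}" by blast
qed (use assms in auto)

lemma image_affine_closed_interval:
  fixes m c :: real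
  assumes "m > 0" "u \<le> v"
  shows "(\<lambda>x. m * x + c) ` {u..v} = {m * u + c..m * v + c}"
  using assms image_affinity_atLeastAtMost[of m c u v] by auto

lemma gaps_image_affine:
  fixes m c :: real
  assumes m: "m > 0"
  defines "\<phi> \<equiv> \<lambda>x. m * x + c"
  shows "gaps (\<phi> ` E) (\<phi> ` A) = (`) \<phi> ` gaps E A"
proof -
  have inj: "inj \<phi>" using m by (auto simp: \<phi>_def inj_on_def)
  have less: "\<phi> u < \<phi> v \<longleftrightarrow> u < v" for u v using m by (simp add: \<phi>_def)
  have op: "{\<phi> u<..<\<phi> v} = \<phi> ` {u<..<v}" for u v
    using image_affine_open_interval[OF m] by (simp add: \<phi>_def)
  have cl: "{\<phi> u..\<phi> v} = \<phi> ` {u..v}" if "u < v" for u v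
    using image_affine_closed_interval[OF m, of u v c] that by (simp add: \<phi>_def)
  have disj: "{\<phi> u<..<\<phi> v} \<inter> \<phi> ` X = {} \<longleftrightarrow> {u<..<v} \<inter> X = {}" for u v X
    unfolding op image_Int[OF inj, symmetric] by simp
  show ?thesis
  proof (intro equalityI subsetI)
    fix C assume "C \<in> gaps (\<phi> ` E) (\<phi> ` A)"
    then obtain u v where "C = {\<phi> u..\<phi> v}" "u \<in> E" "v \<in> E" "\<phi> u < \<phi> v"
      "{\<phi> u<..<\<phi> v} \<inter> \<phi> ` E = {}" "{\<phi> u<..<\<phi> v} \<inter> \<phi> ` A \<noteq> {}"
      unfolding gaps_def by blast
    then have "C = \<phi> ` {u..v}" "{u..v} \<in> gaps E A"
      unfolding disj less gaps_def using cl by auto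
    then show "C \<in> (`) \<phi> ` gaps E A" by blast
  next
    fix C assume "C \<in> (`) \<phi> ` gaps E A"
    then obtain u v where "C = \<phi> ` {u..v}" "u \<in> E" "v \<in> E" "u < v"
      "{u<..<v} \<inter> E = {}" "{u<..<v} \<inter> A \<noteq> {}"
      unfolding gaps_def by blast
    then have "C = {\<phi> u..\<phi> v}" "\<phi> u < \<phi> v" "\<phi> u \<in> \<phi> ` E" "\<phi> v \<in> \<phi> ` E"
      "{\<phi> u<..<\<phi> v} \<inter> \<phi> ` E = {}" "{\<phi> u<..<\<phi> v} \<inter> \<phi> ` A \<noteq> {}"
      using cl by (simp_all add: disj less)
    then show "C \<in> gaps (\<phi> ` E) (\<phi> ` A)" unfolding gaps_def by blast
  qed
qed

section \<open>Ratios read off from maps\<close>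

text \<open>The linear coefficient when \<open>f\<close> is affine. Neighbour sets contain
  functions, not words, so ratios must be recovered from the functions alone.\<close>

definition slope :: "(real \<Rightarrow> real) \<Rightarrow> real" where
  "slope f = f 1 - f 0"

definition max_slope :: "(real \<Rightarrow> real) set \<Rightarrow> real" where
  "max_slope W = Max ((\<lambda>f. \<bar>slope f\<bar>) ` W)"

lemma slope_affine_comp: "slope ((\<lambda>x. m * x + c) \<circ> f) = m * slope f"
  by (simp add: slope_def algebra_simps)

lemma max_slope_affine_comp:
  assumes "m > 0" "finite W" "W \<noteq> {}"
  shows "max_slope ((\<circ>) (\<lambda>x. m * x + c) ` W) = m * max_slope W"
proof -
  have "mono ((*) m)" using assms(1) by (auto simp: mono_def mult_left_mono)
  then have "m * max_slope W = Max ((*) m ` (\<lambda>f. \<bar>slope f\<bar>) ` W)"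
    unfolding max_slope_def using assms by (intro mono_Max_commute) auto
  also have "(*) m ` (\<lambda>f. \<bar>slope f\<bar>) ` W = (\<lambda>f. \<bar>slope f\<bar>) ` (\<circ>) (\<lambda>x. m * x + c) ` W"
    using assms(1) by (simp only: image_image slope_affine_comp) (simp add: abs_mult)
  finally show ?thesis by (simp add: max_slope_def)
qed

lemma affine_to_image_affine:
  fixes m c :: real
  assumes "m > 0" "a < b"
  shows "affine_to ((\<lambda>x. m * x + c) ` {a..b}) = (\<lambda>x. m * x + c) \<circ> affine_to {a..b}"
proof -
  have "m * a + c < m * b + c" using assms by simp
  then have "affine_to {m * a + c..m * b + c} = (\<lambda>x. m * (b - a) * x + (m * a + c))"
    by (simp add: affine_to_def fun_eq_iff algebra_simps)
  moreover have "affine_to {a..b} = (\<lambda>x. (b - a) * x + a)"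
    using assms by (simp add: affine_to_def)
  ultimately show ?thesis
    using assms by (simp add: image_affine_closed_interval fun_eq_iff) (simp add: algebra_simps)
qed

lemma bij_affine_to: "a < b \<Longrightarrow> bij (affine_to {a..b})"
  using bij_betw_byWitness[of UNIV "\<lambda>y. (y - a) / (b - a)" "affine_to {a..b}" UNIV]
  by (simp add: affine_to_def)

section \<open>Word maps, the attractor and the stopping sets \<open>Lambda t\<close>\<close>

context ifs
begin

lemma word_map_Nil [simp]: "word_map [] = id"
  by (simp add: word_map_def)

lemma word_map_Cons [simp]: "word_map (i # \<sigma>) = S i \<circ> word_map \<sigma>"
  by (simp add: word_map_def)

lemma word_map_append: "word_map (\<sigma> @ \<tau>) = word_map \<sigma> \<circ> word_map \<tau>"
  by (induction \<sigma>) auto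

lemma word_ratio_append: "word_ratio (\<sigma> @ \<tau>) = word_ratio \<sigma> * word_ratio \<tau>"
  by (simp add: word_ratio_def)

lemma word_ratio_single: "word_ratio [i] = r i"
  by (simp add: word_ratio_def)

lemma slope_word_map: "slope (word_map \<sigma>) = word_ratio \<sigma>"
proof (induction \<sigma>)
  case (Cons i \<sigma>)
  then show ?case
    by (simp add: S_def word_ratio_def slope_affine_comp del: o_apply)
qed (simp add: slope_def word_ratio_def)

lemma abs_word_ratio_le_1:
  assumes "\<sigma> \<in> lists I"
  shows "\<bar>word_ratio \<sigma>\<bar> \<le> 1"
proof -
  obtain \<rho> where "0 \<le> \<rho>" "\<rho> < 1" "\<bar>word_ratio \<sigma>\<bar> \<le> \<rho> ^ length \<sigma>"
    using word_ratio_bound assms by metis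
  then show ?thesis using power_le_one[of \<rho> "length \<sigma>"] by linarith
qed

lemma abs_word_ratio_append_le:
  assumes "\<tau> \<in> lists I"
  shows "\<bar>word_ratio (\<sigma> @ \<tau>)\<bar> \<le> \<bar>word_ratio \<sigma>\<bar>"
  using mult_left_mono[OF abs_word_ratio_le_1[OF assms], of "\<bar>word_ratio \<sigma>\<bar>"]
  by (simp add: word_ratio_append abs_mult)

lemma K_subset: "K \<subseteq> {0..1}"
  using hull_subset[of K convex] K_hull by simp

text \<open>Extreme points of the convex hull of a set belong to the set itself.\<close>

lemma zero_one_in_K: "0 \<in> K" "1 \<in> K"
proof -
  have "0 extreme_point_of (convex hull K)" "1 extreme_point_of (convex hull K)"
    unfolding K_hull using extreme_point_of_segment[of _ 0 "1::real"]
    by (auto simp: closed_segment_eq_real_ivl)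
  then show "0 \<in> K" "1 \<in> K" by (auto dest: extreme_point_of_convex_hull)
qed

lemma S_in_K: "i \<in> I \<Longrightarrow> x \<in> K \<Longrightarrow> S i x \<in> K"
  by (rule subsetD[OF equalityD2[OF K_invariant]]) (auto simp: S_def)

lemma K_covered_by_S: "x \<in> K \<Longrightarrow> \<exists>i\<in>I. \<exists>y\<in>K. S i y = x"
  using subsetD[OF equalityD1[OF K_invariant], of x] by (auto simp: S_def)

lemma word_map_K_subset: "\<sigma> \<in> lists I \<Longrightarrow> word_map \<sigma> ` K \<subseteq> K"
proof (induction \<sigma>)
  case (Cons i \<sigma>)
  then show ?case using S_in_K by auto
qed simp

lemma word_map_append_K_subset:
  "\<tau> \<in> lists I \<Longrightarrow> word_map (\<sigma> @ \<tau>) ` K \<subseteq> word_map \<sigma> ` K"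
  using word_map_K_subset[of \<tau>] by (auto simp: word_map_append image_comp[symmetric])

lemma Lambda_lists: "\<sigma> \<in> Lambda t \<Longrightarrow> \<sigma> \<in> lists I"
  by (simp add: Lambda_def)

text \<open>Reading the word from the left, the shortest prefix with ratio below \<open>t\<close> is
  in \<open>Lambda t\<close>; for the empty word this is the convention on its predecessor.\<close>

lemma Lambda_prefix:
  assumes "\<sigma> \<in> lists I" "\<bar>word_ratio \<sigma>\<bar> < t"
  shows "\<exists>\<tau> \<rho>. \<sigma> = \<tau> @ \<rho> \<and> \<tau> \<in> Lambda t"
  using assms
proof (induction \<sigma> rule: rev_induct)
  case (snoc i \<sigma>)
  show ?case
  proof (cases "\<bar>word_ratio \<sigma>\<bar> < t")
    case True
    then obtain \<tau> \<rho> where "\<sigma> = \<tau> @ \<rho>" "\<tau> \<in> Lambda t" using snoc by auto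
    then show ?thesis by (intro exI[of _ \<tau>] exI[of _ "\<rho> @ [i]"]) simp
  next
    case False
    then have "\<sigma> @ [i] \<in> Lambda t" using snoc by (auto simp: Lambda_def)
    then show ?thesis by (intro exI[of _ "\<sigma> @ [i]"] exI[of _ "[]"]) simp
  qed
qed (auto simp: Lambda_def)

lemma small_word_ratio:
  assumes "t > 0"
  obtains N where "\<And>\<sigma>. \<sigma> \<in> lists I \<Longrightarrow> N \<le> length \<sigma> \<Longrightarrow> \<bar>word_ratio \<sigma>\<bar> < t"
proof -
  obtain \<rho> where \<rho>: "0 \<le> \<rho>" "\<rho> < 1"
    and pow: "\<And>\<tau>. \<tau> \<in> lists I \<Longrightarrow> \<bar>word_ratio \<tau>\<bar> \<le> \<rho> ^ length \<tau>"
    using word_ratio_bound by blast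
  obtain N where N: "\<rho> ^ N < t" using real_arch_pow_inv[OF assms \<rho>(2)] by blast
  have "\<bar>word_ratio \<sigma>\<bar> < t" if "\<sigma> \<in> lists I" "N \<le> length \<sigma>" for \<sigma>
    using pow[OF that(1)] power_decreasing[OF that(2) \<rho>(1)] \<rho>(2) N by linarith
  then show ?thesis using that by blast
qed

lemma K_covered_by_length: "x \<in> K \<Longrightarrow> \<exists>\<sigma>\<in>lists I. length \<sigma> = n \<and> x \<in> word_map \<sigma> ` K"
proof (induction n arbitrary: x)
  case 0
  then show ?case by (intro bexI[of _ "[]"]) auto
next
  case (Suc n)
  obtain i y where i: "i \<in> I" "y \<in> K" "x = S i y" using K_covered_by_S[OF Suc.prems] by blast
  obtain \<sigma> where "\<sigma> \<in> lists I" "length \<sigma> = n" "y \<in> word_map \<sigma> ` K" using Suc.IH[OF i(2)] by blast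
  then show ?case using i by (intro bexI[of _ "i # \<sigma>"]) auto
qed

text \<open>Words of a large fixed length cover \<open>K\<close> and all have ratio below
  \<open>t\<close>; cutting each back to its prefix in \<open>Lambda t\<close> only enlarges the
  image of \<open>K\<close>.\<close>

lemma K_covered_by_Lambda:
  assumes "t > 0" "x \<in> K"
  shows "\<exists>\<tau>\<in>Lambda t. x \<in> word_map \<tau> ` K"
proof -
  obtain N where N: "\<And>\<sigma>. \<sigma> \<in> lists I \<Longrightarrow> N \<le> length \<sigma> \<Longrightarrow> \<bar>word_ratio \<sigma>\<bar> < t"
    using small_word_ratio[OF assms(1)] by blast
  obtain \<sigma> where \<sigma>: "\<sigma> \<in> lists I" "length \<sigma> = N" "x \<in> word_map \<sigma> ` K"
    using K_covered_by_length[OF assms(2)] by blast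
  then obtain \<tau> \<rho> where \<tau>: "\<sigma> = \<tau> @ \<rho>" "\<tau> \<in> Lambda t" using Lambda_prefix[of \<sigma> t] N[of \<sigma>] by auto
  then have "word_map \<sigma> ` K \<subseteq> word_map \<tau> ` K" using \<sigma> word_map_append_K_subset by auto
  with \<sigma> \<tau> show ?thesis by blast
qed

section \<open>Endpoint sets grow as the generation decreases\<close>

lemma S_attains_endpoint:
  assumes "e \<in> {0, 1}"
  shows "\<exists>i\<in>I. \<exists>e'\<in>{0, 1}. S i e' = e"
proof -
  have "e \<in> K" using assms zero_one_in_K by auto
  then obtain i x where i: "i \<in> I" "x \<in> K" "S i x = e" using K_covered_by_S by blast
  have "S i 0 \<in> K" "S i 1 \<in> K" using S_in_K i(1) zero_one_in_K by blast+
  then have S: "0 \<le> d i" "d i \<le> 1" "0 \<le> r i + d i" "r i + d i \<le> 1"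
    using K_subset by (auto simp: S_def)
  have x: "0 \<le> x" "x \<le> 1" using i K_subset by auto
  \<comment> \<open>\<open>e\<close> is a convex combination of \<open>S i 0\<close> and
    \<open>S i 1\<close>, both in \<open>[0, 1]\<close>. With positive weights, extremality of
    \<open>e\<close> would force both to equal \<open>e\<close>, hence
    \<open>r i = 0\<close>.\<close>
  have eq: "e = (1 - x) * d i + x * (r i + d i)" using i(3) by (simp add: S_def algebra_simps)
  have nz: "r i \<noteq> 0" using ratio[OF i(1)] by auto
  have "x = 0 \<or> x = 1"
  proof (rule ccontr)
    assume "\<not> ?thesis"
    then have x': "0 < x" "x < 1" using x by auto
    from assms consider "e = 0" | "e = 1" by blast
    then show False
    proof cases
      case 1
      have "0 \<le> (1 - x) * d i" "0 \<le> x * (r i + d i)" using x S by auto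
      then have "(1 - x) * d i = 0" "x * (r i + d i) = 0" using eq 1 by linarith+
      then show False using x' nz by auto
    next
      case 2
      have "0 \<le> (1 - x) * (1 - d i)" "0 \<le> x * (1 - (r i + d i))" using x S by auto
      moreover have "(1 - x) * (1 - d i) + x * (1 - (r i + d i)) = 0"
        using eq 2 by (simp add: algebra_simps)
      ultimately have "(1 - x) * (1 - d i) = 0" "x * (1 - (r i + d i)) = 0" by linarith+
      then show False using x' nz by auto
    qed
  qed
  then show ?thesis using i by auto
qed

text \<open>The induction is on the number of letters by which a word can still be extended before it
  is certain to have ratio below \<open>t\<close>.\<close>

lemma word_map_endpoint_in_endpoints:
  assumes "t > 0" "\<sigma> \<in> lists I" "\<sigma> = [] \<or> t \<le> \<bar>word_ratio (butlast \<sigma>)\<bar>" "e \<in> {0, 1}"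
  shows "word_map \<sigma> e \<in> endpoints t"
proof -
  obtain N where N: "\<And>\<sigma>. \<sigma> \<in> lists I \<Longrightarrow> N \<le> length \<sigma> \<Longrightarrow> \<bar>word_ratio \<sigma>\<bar> < t"
    using small_word_ratio[OF assms(1)] by blast
  have "word_map \<sigma> e \<in> endpoints t"
    if "Suc N \<le> length \<sigma> + n" "\<sigma> \<in> lists I" "\<sigma> = [] \<or> t \<le> \<bar>word_ratio (butlast \<sigma>)\<bar>" "e \<in> {0, 1}"
    for n \<sigma> e
    using that
  proof (induction n arbitrary: \<sigma> e)
    \<comment> \<open>Now \<open>\<sigma>\<close> has at least \<open>N + 1\<close> letters, so
      \<open>butlast \<sigma>\<close> has at least \<open>N\<close> and its ratio is below
      \<open>t\<close>, a contradiction. This is the reason for \<open>Suc N\<close> in the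
      bound.\<close>
    case 0
    then have "butlast \<sigma> \<in> lists I" "N \<le> length (butlast \<sigma>)" "\<sigma> \<noteq> []"
      by (auto dest: in_set_butlastD)
    then show ?case using N[of "butlast \<sigma>"] 0 by linarith
  next
    case (Suc n)
    show ?case
    proof (cases "\<bar>word_ratio \<sigma>\<bar> < t")
      case True
      then have "\<sigma> \<in> Lambda t" using Suc.prems by (auto simp: Lambda_def)
      then show ?thesis using Suc.prems(4) unfolding endpoints_def by blast
    next
      case False
      \<comment> \<open>The word is not yet stopped, so it may take one more letter; this letter is
        chosen so that \<open>word_map (\<sigma> @ [i]) e'\<close> is the same point as
        \<open>word_map \<sigma> e\<close>.\<close>
      obtain i e' where i: "i \<in> I" "e' \<in> {0, 1}" "S i e' = e"
        using S_attains_endpoint[OF Suc.prems(4)] by blast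
      have "word_map (\<sigma> @ [i]) e' \<in> endpoints t"
        using Suc.prems i False by (intro Suc.IH) auto
      then show ?thesis using i by (simp add: word_map_append)
    qed
  qed
  from this[of \<sigma> "Suc N"] show ?thesis using assms by simp
qed

text \<open>The predecessor of a word in \<open>Lambda t\<close> has ratio at least
  \<open>t\<close>, hence at least \<open>t'\<close>, so the preceding lemma applies at
  \<open>t'\<close>. It keeps the ends of a net interval among the endpoints at its transition
  generation.\<close>

lemma endpoints_mono:
  assumes "0 < t'" "t' \<le> t"
  shows "endpoints t \<subseteq> endpoints t'"
proof
  fix x assume "x \<in> endpoints t"
  then obtain \<sigma> e where "\<sigma> \<in> Lambda t" "e \<in> {0, 1}" "x = word_map \<sigma> e"
    unfolding endpoints_def by blast
  then show "x \<in> endpoints t'"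
    using assms by (auto simp: Lambda_def intro!: word_map_endpoint_in_endpoints)
qed

section \<open>Covering maps and their subdivision at the transition generation\<close>

text \<open>The neighbours before normalization. Different words may give the same map, and equality
  of neighbour sets compares only maps, so words are forgotten here.\<close>

definition covering_maps :: "real \<Rightarrow> real set \<Rightarrow> (real \<Rightarrow> real) set" where
  "covering_maps t \<Delta> = word_map ` covering_words t \<Delta>"

lemma neighbour_set_eq: "neighbour_set t \<Delta> = (\<circ>) (inv (affine_to \<Delta>)) ` covering_maps t \<Delta>"
  by (auto simp: neighbour_set_def covering_maps_def)

lemma tg_eq: "tg t \<Delta> = max_slope (covering_maps t \<Delta>)"
  unfolding tg_def max_slope_def covering_maps_def image_image slope_word_map
  by (simp add: setcompr_eq_image)

lemma finite_covering_maps: "t > 0 \<Longrightarrow> finite (covering_maps t \<Delta>)"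
  using finite_Lambda by (simp add: covering_maps_def covering_words_def)

lemma covering_maps_nonempty: "t > 0 \<Longrightarrow> \<Delta> \<in> net_intervals t \<Longrightarrow> covering_maps t \<Delta> \<noteq> {}"
  using covering_words_nonempty by (simp add: covering_maps_def)

text \<open>The candidates for the covering maps of all children, before those missing a given child
  are discarded. Only maps and slopes enter, so the step makes sense after an affine change of
  coordinates.\<close>

definition refinement :: "(real \<Rightarrow> real) set \<Rightarrow> (real \<Rightarrow> real) set" where
  "refinement W = {f \<in> W. \<bar>slope f\<bar> < max_slope W} \<union>
     {f \<circ> S i | f i. f \<in> W \<and> \<bar>slope f\<bar> = max_slope W \<and> i \<in> I}"

text \<open>A covering word with ratio below \<open>tg\<close> remains stopped, since its
  predecessor has ratio at least \<open>t > tg\<close>. One with ratio exactly \<open>tg\<close> is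
  not stopped, as \<open>Lambda\<close> demands strict inequality, but any further letter stops
  it.\<close>

lemma refinement_subset_Lambda:
  assumes "t > 0" "\<Delta> \<in> net_intervals t"
  shows "refinement (covering_maps t \<Delta>) \<subseteq> word_map ` Lambda (tg t \<Delta>)"
proof
  fix g assume "g \<in> refinement (covering_maps t \<Delta>)"
  then consider \<sigma> where "\<sigma> \<in> Lambda t" "\<bar>word_ratio \<sigma>\<bar> < tg t \<Delta>" "g = word_map \<sigma>"
    | \<sigma> i where "\<sigma> \<in> Lambda t" "\<bar>word_ratio \<sigma>\<bar> = tg t \<Delta>" "i \<in> I" "g = word_map \<sigma> \<circ> S i"
    unfolding refinement_def tg_eq[symmetric]
    by (fastforce simp: covering_maps_def covering_words_def slope_word_map)
  then show "g \<in> word_map ` Lambda (tg t \<Delta>)"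
  proof cases
    case 1
    then have "\<sigma> \<in> Lambda (tg t \<Delta>)" using tg_bounds[OF assms] by (auto simp: Lambda_def)
    then show ?thesis using 1 by blast
  next
    case 2
    have "tg t \<Delta> * \<bar>r i\<bar> < tg t \<Delta> * 1"
      using ratio[OF 2(3)] tg_bounds(1)[OF assms] by (intro mult_strict_left_mono) auto
    then have "\<sigma> @ [i] \<in> Lambda (tg t \<Delta>)"
      using 2 by (auto simp: Lambda_def word_ratio_append word_ratio_single abs_mult)
    moreover have "g = word_map (\<sigma> @ [i])" using 2 by (simp add: word_map_append)
    ultimately show ?thesis by blast
  qed
qed

text \<open>The prefix \<open>\<tau>\<close> of \<open>\<sigma>\<close> in \<open>Lambda t\<close>
  has a larger image of \<open>K\<close>, so it covers \<open>\<Delta>\<close> and its ratio is at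
  most \<open>tg\<close>. The size of this ratio decides whether \<open>\<sigma>\<close> has no or
  exactly one letter beyond \<open>\<tau>\<close>.\<close>

lemma word_map_in_refinement:
  assumes t: "t > 0" and \<Delta>: "\<Delta> \<in> net_intervals t"
    and \<sigma>: "\<sigma> \<in> Lambda (tg t \<Delta>)" and meets: "word_map \<sigma> ` K \<inter> interior \<Delta> \<noteq> {}"
  shows "word_map \<sigma> \<in> refinement (covering_maps t \<Delta>)"
proof -
  have "\<bar>word_ratio \<sigma>\<bar> < t" using \<sigma> tg_bounds[OF t \<Delta>] by (simp add: Lambda_def)
  then obtain \<tau> \<rho> where \<tau>: "\<sigma> = \<tau> @ \<rho>" "\<tau> \<in> Lambda t"
    using Lambda_prefix Lambda_lists[OF \<sigma>] by blast
  have \<rho>: "\<rho> \<in> lists I" using \<tau> Lambda_lists[OF \<sigma>] by simp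
  have "word_map \<tau> ` K \<inter> interior \<Delta> \<noteq> {}"
    using word_map_append_K_subset[OF \<rho>, of \<tau>] meets \<tau> by blast
  then have W: "word_map \<tau> \<in> covering_maps t \<Delta>"
    using \<tau> by (simp add: covering_maps_def covering_words_def)
  then have "\<bar>slope (word_map \<tau>)\<bar> \<le> tg t \<Delta>"
    unfolding tg_eq max_slope_def using finite_covering_maps[OF t] by (intro Max_ge) auto
  then consider "\<bar>word_ratio \<tau>\<bar> < tg t \<Delta>" | "\<bar>word_ratio \<tau>\<bar> = tg t \<Delta>"
    by (fastforce simp: slope_word_map)
  then show ?thesis
  proof cases
    case 1
    \<comment> \<open>Otherwise \<open>butlast \<sigma>\<close> would still extend
      \<open>\<tau>\<close> and have ratio below \<open>tg\<close>, so \<open>\<sigma>\<close> would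
      have been stopped earlier.\<close>
    have "\<rho> = []"
    proof (rule ccontr)
      assume "\<rho> \<noteq> []"
      moreover have "butlast \<rho> \<in> lists I" using \<rho> by (auto dest: in_set_butlastD)
      ultimately show False
        using \<sigma> \<tau> 1 abs_word_ratio_append_le[of "butlast \<rho>" \<tau>] by (simp add: Lambda_def butlast_append)
    qed
    then show ?thesis using W 1 \<tau> by (simp add: refinement_def tg_eq slope_word_map)
  next
    case 2
    have "\<rho> \<noteq> []" using \<sigma> \<tau> 2 by (auto simp: Lambda_def)
    then obtain i \<mu> where i: "\<rho> = i # \<mu>" by (cases \<rho>) auto
    \<comment> \<open>\<open>\<tau> @ [i]\<close> already has ratio below \<open>tg\<close>, so a
      second extra letter would come after the stopping time.\<close>
    have "\<mu> = []"
    proof (rule ccontr)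
      assume "\<mu> \<noteq> []"
      have "butlast \<mu> \<in> lists I" using \<rho> i by (auto dest: in_set_butlastD)
      from abs_word_ratio_append_le[OF this, of "\<tau> @ [i]"]
      have "tg t \<Delta> \<le> \<bar>word_ratio (\<tau> @ [i])\<bar>"
        using \<sigma> \<tau> i \<open>\<mu> \<noteq> []\<close> by (simp add: Lambda_def butlast_append)
      moreover have "tg t \<Delta> * \<bar>r i\<bar> < tg t \<Delta> * 1"
        using ratio[of i] \<rho> i tg_bounds(1)[OF t \<Delta>] by (intro mult_strict_left_mono) auto
      ultimately show False using 2 by (simp add: word_ratio_append word_ratio_single abs_mult)
    qed
    then have "word_map \<sigma> = word_map \<tau> \<circ> S i" "i \<in> I" using \<tau> \<rho> i by (auto simp: word_map_append)
    moreover have "\<bar>slope (word_map \<tau>)\<bar> = max_slope (covering_maps t \<Delta>)"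
      using 2 by (simp add: tg_eq slope_word_map)
    ultimately show ?thesis using W unfolding refinement_def by blast
  qed
qed

lemma covering_maps_child:
  assumes "t > 0" "\<Delta> \<in> net_intervals t" "C \<subseteq> \<Delta>"
  shows "covering_maps (tg t \<Delta>) C =
    {f \<in> refinement (covering_maps t \<Delta>). f ` K \<inter> interior C \<noteq> {}}"
proof -
  have in_refinement: "f \<in> refinement (covering_maps t \<Delta>)"
    if f: "f \<in> word_map ` Lambda (tg t \<Delta>)" "f ` K \<inter> interior C \<noteq> {}" for f
  proof -
    have "f ` K \<inter> interior \<Delta> \<noteq> {}" using f(2) interior_mono[OF assms(3)] by blast
    then show ?thesis using f(1) word_map_in_refinement[OF assms(1,2)] by auto
  qed
  have "covering_maps (tg t \<Delta>) C =
      {f \<in> word_map ` Lambda (tg t \<Delta>). f ` K \<inter> interior C \<noteq> {}}"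
    unfolding covering_maps_def covering_words_def by blast
  also have "\<dots> = {f \<in> refinement (covering_maps t \<Delta>). f ` K \<inter> interior C \<noteq> {}}"
    using in_refinement subsetD[OF refinement_subset_Lambda[OF assms(1,2)]]
    by (intro Collect_cong conj_cong iffI refl) simp_all
  finally show ?thesis .
qed

section \<open>Children in terms of covering maps\<close>

text \<open>The ends \<open>a\<close>, \<open>b\<close> persist from generation \<open>t\<close>;
  they are listed apart because they may come from maps that do not cover the interval. An endpoint
  strictly inside lies in the image of \<open>K\<close>, as \<open>0\<close> and \<open>1\<close>
  are in \<open>K\<close>, so its map is in the refinement.\<close>

lemma endpoints_tg:
  assumes t: "t > 0" and \<Delta>: "{a..b} \<in> net_intervals t"
  shows "endpoints (tg t {a..b}) \<inter> {a..b} =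
    {a, b} \<union> ((\<Union>f\<in>refinement (covering_maps t {a..b}). {f 0, f 1}) \<inter> {a<..<b})"
proof -
  have ab: "a < b" "{a, b} \<subseteq> endpoints t"
    using \<Delta> by (auto simp: net_intervals_def Icc_eq_Icc)
  then have 1: "{a, b} \<subseteq> endpoints (tg t {a..b})"
    using endpoints_mono[of "tg t {a..b}" t] tg_bounds[OF t \<Delta>] by auto
  have "x \<in> endpoints (tg t {a..b}) \<longleftrightarrow> (\<exists>f\<in>refinement (covering_maps t {a..b}). x \<in> {f 0, f 1})"
    if x: "x \<in> {a<..<b}" for x
  proof
    assume "x \<in> endpoints (tg t {a..b})"
    then obtain \<sigma> where \<sigma>: "\<sigma> \<in> Lambda (tg t {a..b})" "x \<in> {word_map \<sigma> 0, word_map \<sigma> 1}"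
      unfolding endpoints_def by blast
    moreover have "x \<in> word_map \<sigma> ` K" using \<sigma> zero_one_in_K by blast
    then have "word_map \<sigma> ` K \<inter> interior {a..b} \<noteq> {}" using x by auto
    ultimately show "\<exists>f\<in>refinement (covering_maps t {a..b}). x \<in> {f 0, f 1}"
      using word_map_in_refinement[OF t \<Delta>] by blast
  next
    assume "\<exists>f\<in>refinement (covering_maps t {a..b}). x \<in> {f 0, f 1}"
    then show "x \<in> endpoints (tg t {a..b})"
      using refinement_subset_Lambda[OF t \<Delta>] unfolding endpoints_def by blast
  qed
  then have "endpoints (tg t {a..b}) \<inter> {a<..<b} =
      (\<Union>f\<in>refinement (covering_maps t {a..b}). {f 0, f 1}) \<inter> {a<..<b}" by blast
  moreover have "E \<inter> {a..b} = {a, b} \<union> (E \<inter> {a<..<b})" if "{a, b} \<subseteq> E" for E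
    using that ab(1) by auto
  ultimately show ?thesis using 1 by simp
qed

text \<open>Any word of \<open>Lambda t\<close> whose image of \<open>K\<close> contains a point
  inside the interval is a covering word by definition.\<close>

lemma K_Int_net_interval:
  assumes "t > 0"
  shows "K \<inter> {a<..<b} = (\<Union>f\<in>covering_maps t {a..b}. f ` K) \<inter> {a<..<b}"
proof (intro equalityI subsetI)
  fix x assume x: "x \<in> K \<inter> {a<..<b}"
  then obtain \<tau> where "\<tau> \<in> Lambda t" "x \<in> word_map \<tau> ` K"
    using K_covered_by_Lambda[OF assms] by blast
  moreover from this have "\<tau> \<in> covering_words t {a..b}"
    using x by (auto simp: covering_words_def)
  ultimately show "x \<in> (\<Union>f\<in>covering_maps t {a..b}. f ` K) \<inter> {a<..<b}"
    using x by (auto simp: covering_maps_def)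
next
  fix x assume "x \<in> (\<Union>f\<in>covering_maps t {a..b}. f ` K) \<inter> {a<..<b}"
  then show "x \<in> K \<inter> {a<..<b}"
    using word_map_K_subset Lambda_lists by (fastforce simp: covering_maps_def covering_words_def)
qed

lemma children_eq_gaps:
  "children t {a..b} = gaps (endpoints (tg t {a..b}) \<inter> {a..b}) (K \<inter> {a<..<b})"
proof (intro equalityI subsetI)
  fix C assume "C \<in> children t {a..b}"
  then obtain u v where C: "C = {u..v}" "u \<in> endpoints (tg t {a..b})" "v \<in> endpoints (tg t {a..b})"
      "u < v" "{u<..<v} \<inter> endpoints (tg t {a..b}) = {}" "{u<..<v} \<inter> K \<noteq> {}" "C \<subseteq> {a..b}"
    unfolding children_def net_intervals_def by blast
  moreover from C have "a \<le> u" "v \<le> b" by auto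
  moreover from this have "{u<..<v} \<subseteq> {a<..<b}" by auto
  ultimately show "C \<in> gaps (endpoints (tg t {a..b}) \<inter> {a..b}) (K \<inter> {a<..<b})"
    unfolding gaps_def by (intro CollectI exI[of _ u] exI[of _ v]) auto
next
  fix C assume "C \<in> gaps (endpoints (tg t {a..b}) \<inter> {a..b}) (K \<inter> {a<..<b})"
  then obtain u v where C: "C = {u..v}" "u \<in> endpoints (tg t {a..b}) \<inter> {a..b}"
      "v \<in> endpoints (tg t {a..b}) \<inter> {a..b}" "u < v"
      "{u<..<v} \<inter> (endpoints (tg t {a..b}) \<inter> {a..b}) = {}" "{u<..<v} \<inter> (K \<inter> {a<..<b}) \<noteq> {}"
    unfolding gaps_def by blast
  \<comment> \<open>Nothing is lost by restricting the endpoints to the parent: the open gap between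
    \<open>u\<close> and \<open>v\<close> stays inside it.\<close>
  moreover from C have "{u..v} \<subseteq> {a..b}" "{u<..<v} \<subseteq> {a..b}" by auto
  ultimately show "C \<in> children t {a..b}"
    unfolding children_def net_intervals_def by blast
qed

section \<open>Transport along an increasing affine map\<close>

text \<open>Composing on the left multiplies every absolute slope and their maximum by
  \<open>m\<close>, so the two cases are respected; subdivision composes on the right with
  \<open>S i\<close>, which commutes with this by associativity.\<close>

lemma refinement_affine_comp:
  assumes "m > 0" "finite W" "W \<noteq> {}"
  shows "refinement ((\<circ>) (\<lambda>x. m * x + c) ` W) = (\<circ>) (\<lambda>x. m * x + c) ` refinement W"
proof -
  define \<phi> where "\<phi> = (\<lambda>x. m * x + c)"
  have max: "max_slope ((\<circ>) \<phi> ` W) = m * max_slope W"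
    unfolding \<phi>_def by (rule max_slope_affine_comp[OF assms])
  have "\<bar>slope (\<phi> \<circ> f)\<bar> = m * \<bar>slope f\<bar>" for f
    using assms(1) unfolding \<phi>_def slope_affine_comp by (simp add: abs_mult)
  then have "\<bar>slope (\<phi> \<circ> f)\<bar> < max_slope ((\<circ>) \<phi> ` W) \<longleftrightarrow> \<bar>slope f\<bar> < max_slope W"
    "\<bar>slope (\<phi> \<circ> f)\<bar> = max_slope ((\<circ>) \<phi> ` W) \<longleftrightarrow> \<bar>slope f\<bar> = max_slope W" for f
    using assms(1) max by simp_all
  then have "refinement ((\<circ>) \<phi> ` W) = (\<circ>) \<phi> ` refinement W"
    unfolding refinement_def by (auto simp: comp_assoc image_iff) (metis comp_assoc)+
  then show ?thesis by (simp add: \<phi>_def)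
qed

lemma affine_transport:
  fixes t s :: real
  assumes t: "t > 0" and \<Delta>: "{a..b} \<in> net_intervals t"
    and s: "s > 0" and \<Delta>': "(\<lambda>x. m * x + c) ` {a..b} \<in> net_intervals s"
    and m: "m > 0"
    and W: "covering_maps s ((\<lambda>x. m * x + c) ` {a..b}) =
      (\<circ>) (\<lambda>x. m * x + c) ` covering_maps t {a..b}"
  defines "\<phi> \<equiv> \<lambda>x. m * x + c"
  shows tg_transport: "tg s (\<phi> ` {a..b}) = m * tg t {a..b}"
    and children_transport: "children s (\<phi> ` {a..b}) = (`) \<phi> ` children t {a..b}"
    and covering_maps_transport: "\<And>C. C \<in> children t {a..b} \<Longrightarrow>
      covering_maps (tg s (\<phi> ` {a..b})) (\<phi> ` C) = (\<circ>) \<phi> ` covering_maps (tg t {a..b}) C"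
proof -
  note W = W[folded \<phi>_def] and \<Delta>' = \<Delta>'[folded \<phi>_def]
  have ab: "a < b" using \<Delta> by (auto simp: net_intervals_def Icc_eq_Icc)
  have img: "\<phi> ` {a..b} = {\<phi> a..\<phi> b}"
    using image_affine_closed_interval[OF m, of a b c] ab by (simp add: \<phi>_def)
  have op: "{\<phi> u<..<\<phi> v} = \<phi> ` {u<..<v}" for u v
    using image_affine_open_interval[OF m] by (simp add: \<phi>_def)
  have inj: "inj \<phi>" using m by (auto simp: \<phi>_def inj_on_def)
  have fin: "finite (covering_maps t {a..b})" "covering_maps t {a..b} \<noteq> {}"
    using finite_covering_maps[OF t] covering_maps_nonempty[OF t \<Delta>] by auto
  show "tg s (\<phi> ` {a..b}) = m * tg t {a..b}"
    unfolding tg_eq W unfolding \<phi>_def by (rule max_slope_affine_comp[OF m fin])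
  have ref: "refinement (covering_maps s (\<phi> ` {a..b})) = (\<circ>) \<phi> ` refinement (covering_maps t {a..b})"
    unfolding W unfolding \<phi>_def by (rule refinement_affine_comp[OF m fin])
  \<comment> \<open>Both ingredients of the children, endpoints and points of \<open>K\<close>
    inside the parent, are functions of the covering maps, so \<open>W\<close> moves them by
    \<open>\<phi>\<close>.\<close>
  have "endpoints (tg s (\<phi> ` {a..b})) \<inter> \<phi> ` {a..b} = \<phi> ` (endpoints (tg t {a..b}) \<inter> {a..b})"
    unfolding endpoints_tg[OF t \<Delta>] unfolding img endpoints_tg[OF s \<Delta>'[unfolded img]]
    unfolding img[symmetric] ref op image_Un image_Int[OF inj] image_UN by simp
  moreover have "K \<inter> {\<phi> a<..<\<phi> b} = \<phi> ` (K \<inter> {a<..<b})"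
    unfolding K_Int_net_interval[OF t, of a b] K_Int_net_interval[OF s, of "\<phi> a" "\<phi> b"]
    unfolding img[symmetric] W op
      image_Int[OF inj] image_UN by (simp add: image_comp)
  ultimately show "children s (\<phi> ` {a..b}) = (`) \<phi> ` children t {a..b}"
    unfolding img children_eq_gaps using gaps_image_affine[OF m, of c, folded \<phi>_def] by simp
  fix C assume "C \<in> children t {a..b}"
  then obtain u v where C: "C = {u..v}" "u < v" "C \<subseteq> {a..b}"
    unfolding children_def net_intervals_def by blast
  have int: "interior (\<phi> ` C) = \<phi> ` interior C"
    using image_affine_closed_interval[OF m, of u v c] C op[of u v] by (simp add: \<phi>_def)
  have "(\<phi> \<circ> f) ` K \<inter> interior (\<phi> ` C) = \<phi> ` (f ` K \<inter> interior C)" for f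
    unfolding int image_Int[OF inj] by (simp add: image_comp)
  then have "(\<phi> \<circ> f) ` K \<inter> interior (\<phi> ` C) \<noteq> {} \<longleftrightarrow> f ` K \<inter> interior C \<noteq> {}" for f by simp
  moreover have "\<phi> ` C \<subseteq> \<phi> ` {a..b}" using C by blast
  ultimately show "covering_maps (tg s (\<phi> ` {a..b})) (\<phi> ` C) = (\<circ>) \<phi> ` covering_maps (tg t {a..b}) C"
    unfolding covering_maps_child[OF t \<Delta> C(3)] covering_maps_child[OF s \<Delta>' \<open>\<phi> ` C \<subseteq> _\<close>] ref
    by (simp only: Compr_image_eq)
qed

lemma ordered_children_transport:
  assumes m: "m > 0"
    and ch: "children s \<Delta>' = (`) (\<lambda>x. m * x + c) ` children t \<Delta>"
    and "ordered_children t \<Delta> \<Delta>s"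
  shows "ordered_children s \<Delta>' (map ((`) (\<lambda>x. m * x + c)) \<Delta>s)"
proof -
  have \<Delta>s: "set \<Delta>s = children t \<Delta>" "sorted_wrt (\<lambda>A B. Inf A < Inf B) \<Delta>s"
    using assms(3) by (auto simp: ordered_children_def)
  have "Inf ((\<lambda>x. m * x + c) ` A) = m * Inf A + c" if "A \<in> set \<Delta>s" for A
  proof -
    have "A \<in> children t \<Delta>" using that \<Delta>s(1) by simp
    then obtain u v where "A = {u..v}" "u < v"
      unfolding children_def net_intervals_def by blast
    then show ?thesis using image_affine_closed_interval[OF m, of u v c] m by simp
  qed
  then have "sorted_wrt (\<lambda>A B. Inf A < Inf B) (map ((`) (\<lambda>x. m * x + c)) \<Delta>s)"
    unfolding sorted_wrt_map by (intro sorted_wrt_mono_rel[OF _ \<Delta>s(2)]) (use m in auto)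
  then show ?thesis using \<Delta>s(1) ch by (simp add: ordered_children_def)
qed

section \<open>Equal neighbour sets and comparison of the children\<close>

lemma equal_neighbour_sets_imp_affine:
  assumes "\<Delta> \<in> net_intervals t" "\<Delta>' \<in> net_intervals s"
    and V: "neighbour_set t \<Delta> = neighbour_set s \<Delta>'"
  obtains m c where "m > 0" "\<Delta>' = (\<lambda>x. m * x + c) ` \<Delta>"
    "covering_maps s \<Delta>' = (\<circ>) (\<lambda>x. m * x + c) ` covering_maps t \<Delta>"
proof -
  obtain a b where ab: "\<Delta> = {a..b}" "a < b" using assms(1) by (auto simp: net_intervals_def)
  obtain a' b' where ab': "\<Delta>' = {a'..b'}" "a' < b'" using assms(2) by (auto simp: net_intervals_def)
  \<comment> \<open>The increasing affine map taking \<open>a\<close> to \<open>a'\<close> and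
    \<open>b\<close> to \<open>b'\<close>.\<close>
  define m where "m = (b' - a') / (b - a)"
  define c where "c = a' - m * a"
  have "m * (b - a) = b' - a'" using ab by (simp add: m_def)
  then have m: "m > 0" "m * a + c = a'" "m * b + c = b'"
    using ab ab' by (simp_all add: m_def c_def right_diff_distrib)
  have img: "\<Delta>' = (\<lambda>x. m * x + c) ` \<Delta>"
    using image_affine_closed_interval[of m a b c] ab ab' m by simp
  have T: "affine_to \<Delta>' = (\<lambda>x. m * x + c) \<circ> affine_to \<Delta>"
    using affine_to_image_affine[of m a b c] m ab img by simp
  have "affine_to \<Delta>' \<circ> (inv (affine_to \<Delta>') \<circ> f) = f"
    "affine_to \<Delta> \<circ> (inv (affine_to \<Delta>) \<circ> f) = f" for f :: "real \<Rightarrow> real"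
    using bij_affine_to[OF ab(2)] bij_affine_to[OF ab'(2)] ab(1) ab'(1)
    by (simp_all add: fun_eq_iff bij_is_surj surj_f_inv_f)
  \<comment> \<open>Undoing the normalization: the common neighbour set yields the covering maps of
    either interval, and the two ways of undoing it differ by the affine map just found.\<close>
  then have inv: "(\<circ>) (affine_to \<Delta>') ` neighbour_set s \<Delta>' = covering_maps s \<Delta>'"
    "(\<circ>) (affine_to \<Delta>) ` neighbour_set t \<Delta> = covering_maps t \<Delta>"
    by (simp_all add: neighbour_set_eq image_image)
  have "covering_maps s \<Delta>' = (\<circ>) (\<lambda>x. m * x + c) ` covering_maps t \<Delta>"
    unfolding inv[symmetric] V[symmetric] T by (simp add: image_image o_assoc)
  then show ?thesis using that m(1) img by blast
qed

text \<open>The converse passage, applied to children: normalization of the image interval contains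
  the inverse of the affine map, which cancels.\<close>

lemma neighbour_set_affine:
  assumes "m > 0" "u < v"
    and W: "covering_maps s ((\<lambda>x. m * x + c) ` {u..v}) = (\<circ>) (\<lambda>x. m * x + c) ` covering_maps t {u..v}"
  shows "neighbour_set s ((\<lambda>x. m * x + c) ` {u..v}) = neighbour_set t {u..v}"
proof -
  define \<phi> where "\<phi> = (\<lambda>x. m * x + c)"
  have "bij \<phi>"
    using bij_betw_byWitness[of UNIV "\<lambda>y. (y - c) / m" \<phi> UNIV] assms(1) by (simp add: \<phi>_def)
  then have "inv (\<phi> \<circ> affine_to {u..v}) \<circ> (\<phi> \<circ> f) = inv (affine_to {u..v}) \<circ> f" for f :: "real \<Rightarrow> real"
    using bij_affine_to[OF assms(2)] by (simp add: o_inv_distrib fun_eq_iff bij_is_inj)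
  then have "neighbour_set s (\<phi> ` {u..v}) = neighbour_set t {u..v}"
    unfolding neighbour_set_eq W[folded \<phi>_def] affine_to_image_affine[OF assms(1,2), of c, folded \<phi>_def]
    by (simp add: image_image)
  then show ?thesis by (simp add: \<phi>_def)
qed

lemma equal_neighbour_sets_children:
  assumes t: "t > 0" and \<Delta>: "\<Delta> \<in> net_intervals t" and \<Delta>s: "ordered_children t \<Delta> \<Delta>s"
    and s: "s > 0" and \<Delta>': "\<Delta>' \<in> net_intervals s"
    and V: "neighbour_set t \<Delta> = neighbour_set s \<Delta>'"
    and \<Delta>s': "ordered_children s \<Delta>' \<Delta>s'"
  shows "length \<Delta>s = length \<Delta>s' \<and>
    (\<forall>i < length \<Delta>s.
       neighbour_set (tg s \<Delta>') (\<Delta>s' ! i) = neighbour_set (tg t \<Delta>) (\<Delta>s ! i) \<and>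
       position_index \<Delta>' (\<Delta>s' ! i) = position_index \<Delta> (\<Delta>s ! i) \<and>
       diameter (\<Delta>s' ! i) / diameter \<Delta>' = diameter (\<Delta>s ! i) / diameter \<Delta> \<and>
       tg (tg t \<Delta>) (\<Delta>s ! i) / tg t \<Delta> = tg (tg s \<Delta>') (\<Delta>s' ! i) / tg s \<Delta>')"
proof -
  obtain m c where m: "m > 0" and img: "\<Delta>' = (\<lambda>x. m * x + c) ` \<Delta>"
    and W: "covering_maps s \<Delta>' = (\<circ>) (\<lambda>x. m * x + c) ` covering_maps t \<Delta>"
    using equal_neighbour_sets_imp_affine[OF \<Delta> \<Delta>' V] by blast
  obtain a b where ab: "\<Delta> = {a..b}" "a < b" using \<Delta> by (auto simp: net_intervals_def)
  note tr = t \<Delta>[unfolded ab(1)] s \<Delta>'[unfolded img ab(1)] m W[unfolded img ab(1)]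
  have tg: "tg s \<Delta>' = m * tg t \<Delta>"
    using tg_transport[OF tr] by (simp add: img ab)
  have ch: "children s \<Delta>' = (`) (\<lambda>x. m * x + c) ` children t \<Delta>"
    using children_transport[OF tr] by (simp add: img ab)
  \<comment> \<open>The image list is ordered, and the ordered list of children is unique, so
    corresponding indices mean corresponding children.\<close>
  have map: "\<Delta>s' = map ((`) (\<lambda>x. m * x + c)) \<Delta>s"
    using ordered_children_transport[OF m ch \<Delta>s] \<Delta>s' ordered_children_exists[OF s \<Delta>'] by blast
  have \<Delta>'_eq: "\<Delta>' = {m * a + c..m * b + c}"
    using image_affine_closed_interval[OF m, of a b c] ab img by simp
  have ab': "m * a + c < m * b + c" using m ab by simp
  have child: "neighbour_set (tg s \<Delta>') C' = neighbour_set (tg t \<Delta>) C \<and>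
       position_index \<Delta>' C' = position_index \<Delta> C \<and>
       diameter C' / diameter \<Delta>' = diameter C / diameter \<Delta> \<and>
       tg (tg t \<Delta>) C / tg t \<Delta> = tg (tg s \<Delta>') C' / tg s \<Delta>'"
    if C: "C \<in> children t \<Delta>" and C': "C' = (\<lambda>x. m * x + c) ` C" for C C'
  proof -
    obtain u v where uv: "C = {u..v}" "u < v" and Cnet: "C \<in> net_intervals (tg t \<Delta>)"
      using C unfolding children_def net_intervals_def by blast
    have C'_eq: "C' = {m * u + c..m * v + c}"
      using image_affine_closed_interval[OF m, of u v c] uv C' by simp
    have uv': "m * u + c < m * v + c" using m uv by simp
    have cov: "covering_maps (tg s \<Delta>') C' = (\<circ>) (\<lambda>x. m * x + c) ` covering_maps (tg t \<Delta>) C"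
      using covering_maps_transport[OF tr] C by (simp add: img ab C')
    have "position_index \<Delta>' C' = position_index \<Delta> C"
      using ab' uv' ab uv m unfolding position_index_def \<Delta>'_eq C'_eq by (simp flip: right_diff_distrib)
    moreover have "diameter C' / diameter \<Delta>' = diameter C / diameter \<Delta>"
      using ab' uv' ab uv m unfolding \<Delta>'_eq C'_eq by (simp flip: right_diff_distrib)
    moreover have "neighbour_set (tg s \<Delta>') C' = neighbour_set (tg t \<Delta>) C"
      using neighbour_set_affine[OF m uv(2)] cov by (simp add: C' uv(1))
    \<comment> \<open>The covering maps of the child are moved by the same map as those of the
      parent, so both transition generations gain the factor \<open>m\<close>, which cancels in
      (iv).\<close>
    moreover have "tg (tg s \<Delta>') C' = m * tg (tg t \<Delta>) C"
      unfolding tg_eq[of _ C] tg_eq[of _ C'] cov using tg_bounds(1)[OF t \<Delta>] Cnet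
      by (intro max_slope_affine_comp[OF m] finite_covering_maps covering_maps_nonempty)
    ultimately show ?thesis using m by (simp add: tg)
  qed
  have "set \<Delta>s = children t \<Delta>" using \<Delta>s by (simp add: ordered_children_def)
  then have "\<Delta>s ! i \<in> children t \<Delta>" if "i < length \<Delta>s" for i using that nth_mem by blast
  then show ?thesis using child by (simp add: map)
qed

end

theorem theorem2p8:
  fixes I :: "'i set" and r d :: "'i \<Rightarrow> real" and K :: "real set"
    and t s :: real and \<Delta> \<Delta>' :: "real set" and \<Delta>s \<Delta>s' :: "real set list"
  assumes "ifs I r d K"
    and "t > 0" and "\<Delta> \<in> ifs.net_intervals I r d K t"
    and "ifs.ordered_children I r d K t \<Delta> \<Delta>s"
    and "s > 0" and "\<Delta>' \<in> ifs.net_intervals I r d K s"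
    and "ifs.neighbour_set I r d K t \<Delta> = ifs.neighbour_set I r d K s \<Delta>'"
    and "ifs.ordered_children I r d K s \<Delta>' \<Delta>s'"
  shows "length \<Delta>s = length \<Delta>s' \<and>
    (\<forall>i < length \<Delta>s.
       ifs.neighbour_set I r d K (ifs.tg I r d K s \<Delta>') (\<Delta>s' ! i) =
         ifs.neighbour_set I r d K (ifs.tg I r d K t \<Delta>) (\<Delta>s ! i) \<and>
       position_index \<Delta>' (\<Delta>s' ! i) = position_index \<Delta> (\<Delta>s ! i) \<and>
       diameter (\<Delta>s' ! i) / diameter \<Delta>' = diameter (\<Delta>s ! i) / diameter \<Delta> \<and>
       ifs.tg I r d K (ifs.tg I r d K t \<Delta>) (\<Delta>s ! i) / ifs.tg I r d K t \<Delta> =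
         ifs.tg I r d K (ifs.tg I r d K s \<Delta>') (\<Delta>s' ! i) / ifs.tg I r d K s \<Delta>')"
  using assms by (rule ifs.equal_neighbour_sets_children)

end
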